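(* For $b\ge4$, the number of terms in the expansion of the Kauffman bracket polynomial $f_b$ of $T(3,b)$ produced by the recursion rules (A), (f), (C) described in the context is $a(b+4)$, where $a$ is the Padovan sequence (OEIS A000931) defined by $a(0)=1$, $a(1)=a(2)=0$ and $a(n)=a(n-2)+a(n-3)$ for $n\ge3$. That is, the numbers of terms form a sequence that is an offset by four of the Padovan sequence.
   Context: $f_b$ denotes the Kauffman bracket polynomial of the 3-strand billiard table (Chebyshev) diagram $T(3,b)$, which has $b-1$ crossings in a row, numbered from left to right, with indeterminate signs $\varepsilon_k$. A tuple of entries denotes their product, where the entry in position $k$ depends on the sign of the $k$-th crossing: $A^\pm\mapsto A^{\varepsilon_k}$, $A^\mp\mapsto A^{-\varepsilon_k}$, $f_2^\pm\mapsto-A^{-3\varepsilon_k}$, $f_2^\mp\mapsto-A^{3\varepsilon_k}$. Put $C=[A^\pm,A^\pm]+[f_2^\mp,A^\mp]$. The expansion in question is a formal sum of tuples (terms), each consisting of an initial symbol $f_3$ or $f_2^\pm$ followed by symbols $A^\pm$, $[f_2^\mp,A^\mp]$, $C$, defined recursively: $f_4=(f_3,A^\pm)+(f_2^\pm,[f_2^\mp,A^\mp])$, and for $b\ge5$ the expansion of $f_b$ is obtained from that of $f_{b-1}$ by replacing each term as follows: (A) a term $(\ldots,A^\pm)$ becomes $(\ldots,C)$; (f) a term $(\ldots,[f_2^\mp,A^\mp])$ becomes $(\ldots,[f_2^\mp,A^\mp],A^\pm)$; (C) a term $(\ldots,C)$ becomes the two terms $(\ldots,C,A^\pm)+(\ldots,A^\pm,[f_2^\mp,A^\mp])$.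 The number of terms is the number of tuples in this formal sum, where the symbols $f_3$, $C$, etc. are not expanded further (so $f_4$ has 2 terms, $f_5$ has 2, $f_6$ has 3). *)

theory Defs
  imports "HOL-Library.Multiset"
begin

text \<open>
  Terms are kept as uninterpreted tuples: the symbols below are formal, and the signs
  of the crossings enter only through the positions of the symbols when a tuple is
  evaluated as a product.
  \<open>Ini_f3\<close> is $f_3$ and \<open>Ini_f2\<close> is $f_2^{\pm}$.
  \<open>Sym_A\<close> is $A^{\pm}$, \<open>Sym_fA\<close> is the single bracketed symbol $[f_2^{\mp},A^{\mp}]$, and
  \<open>Sym_C\<close> is $C = [A^{\pm},A^{\pm}] + [f_2^{\mp},A^{\mp}]$, which is not expanded.
\<close>

datatype initial_symbol = Ini_f3 | Ini_f2

datatype bracket_symbol = Sym_A | Sym_fA | Sym_C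

type_synonym bracket_term = "initial_symbol \<times> bracket_symbol list"

text \<open>
  The replacement rules (A), (f), (C) act on the last symbol of a term. The
  value on a term without any symbol after the initial one is irrelevant, since no such
  term occurs in an expansion.
\<close>

fun replace_term :: "bracket_term \<Rightarrow> bracket_term multiset" where
  "replace_term (i, xs) =
     (case last xs of
        Sym_A \<Rightarrow> {# (i, butlast xs @ [Sym_C]) #}
      | Sym_fA \<Rightarrow> {# (i, butlast xs @ [Sym_fA, Sym_A]) #}
      | Sym_C \<Rightarrow> {# (i, butlast xs @ [Sym_C, Sym_A]), (i, butlast xs @ [Sym_A, Sym_fA]) #})"

text \<open>
  A formal sum of terms is a multiset, so that terms are counted with multiplicity.
  The expansion of $f_b$ is meaningful only for $b \ge 4$.
\<close>

fun expansion :: "nat \<Rightarrow> bracket_term multiset" where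
  "expansion b =
     (if b < 4 then {#}
      else if b = 4 then {# (Ini_f3, [Sym_A]), (Ini_f2, [Sym_fA]) #}
      else \<Sum>\<^sub># (image_mset replace_term (expansion (b - 1))))"

declare expansion.simps [simp del]

definition number_of_terms :: "nat \<Rightarrow> nat" where
  "number_of_terms b = size (expansion b)"

fun padovan :: "nat \<Rightarrow> nat" where
  "padovan 0 = 1"
| "padovan (Suc 0) = 0"
| "padovan (Suc (Suc 0)) = 0"
| "padovan (Suc (Suc (Suc n))) = padovan (Suc n) + padovan n"

end

theory Submission
  imports Defs
begin

text \<open>
  A replacement rule looks only at the last symbol of a term, and the last symbols of the
  terms it produces depend on nothing else: \<open>A\<close> gives \<open>C\<close>, \<open>[f\<^sub>2, A]\<close> gives \<open>A\<close>, and \<open>C\<close> gives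
  one \<open>A\<close> and one \<open>[f\<^sub>2, A]\<close>. To count terms it therefore suffices to follow the multiset of
  last symbols. If \<open>x\<close>, \<open>y\<close>, \<open>z\<close> are the multiplicities of \<open>A\<close>, \<open>[f\<^sub>2, A]\<close> and \<open>C\<close>, one step of the
  recursion sends \<open>(x, y, z)\<close> to \<open>(y + z, z, x)\<close> (lemma \<open>count_last_symbols_replace\<close>).

  Write \<open>z\<^sub>b\<close> for the multiplicity of \<open>C\<close> in the expansion of \<open>f\<^sub>b\<close>. The \<open>A\<close> at \<open>b\<close> become the
  \<open>C\<close> at \<open>b + 1\<close>, and for \<open>b > 4\<close> the \<open>[f\<^sub>2, A]\<close> at \<open>b\<close> come from the \<open>C\<close> at \<open>b - 1\<close>. So
  \<open>(x, y, z)\<close> consists of \<open>z\<close> at the indices \<open>b + 1\<close>, \<open>b - 1\<close>, \<open>b\<close>, and \<open>x' = y + z\<close> reads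
  \<open>z\<^bsub>b+2\<^esub> = z\<^bsub>b-1\<^esub> + z\<^sub>b\<close>, which is the Padovan recurrence. The starting values \<open>(1, 1, 0)\<close>
  at \<open>b = 4\<close> are \<open>(a(5), a(3), a(4))\<close>, so that \<open>(x, y, z) = (a(b+1), a(b-1), a(b))\<close> for every
  \<open>b \<ge> 4\<close> (lemma \<open>count_last_symbols_expansion\<close>). The total is
  \<open>a(b+1) + (a(b) + a(b-1)) = a(b+1) + a(b+2) = a(b+4)\<close>.
\<close>

definition last_symbols :: "bracket_term multiset \<Rightarrow> bracket_symbol multiset" where
  "last_symbols M = image_mset (\<lambda>t. last (snd t)) M"

lemma size_eq_sum_of_last_symbol_counts:
  "size M = count (last_symbols M) Sym_A + count (last_symbols M) Sym_fA
            + count (last_symbols M) Sym_C"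
proof (induction M)
  case empty
  then show ?case by (simp add: last_symbols_def)
next
  case (add t M)
  then show ?case by (cases "last (snd t)") (simp_all add: last_symbols_def)
qed

lemma last_symbols_replace_term:
  "last_symbols (replace_term t) =
     (case last (snd t) of
        Sym_A \<Rightarrow> {# Sym_C #}
      | Sym_fA \<Rightarrow> {# Sym_A #}
      | Sym_C \<Rightarrow> {# Sym_A, Sym_fA #})"
  by (cases t) (simp add: last_symbols_def split: bracket_symbol.split)

text \<open>
  The transfer matrix of the substitution on last symbols: each equation collects the
  symbols whose replacement contains the symbol on the left.
\<close>

lemma count_last_symbols_replace:
  defines "R \<equiv> \<lambda>M. last_symbols (\<Sum>\<^sub># (image_mset replace_term M))"
  shows "count (R M) Sym_A = count (last_symbols M) Sym_fA + count (last_symbols M) Sym_C"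
    and "count (R M) Sym_fA = count (last_symbols M) Sym_C"
    and "count (R M) Sym_C = count (last_symbols M) Sym_A"
proof -
  have R_add_mset: "R (add_mset t M) = last_symbols (replace_term t) + R M" for t M
    by (simp add: R_def last_symbols_def)
  have "count (R M) Sym_A = count (last_symbols M) Sym_fA + count (last_symbols M) Sym_C
      \<and> count (R M) Sym_fA = count (last_symbols M) Sym_C
      \<and> count (R M) Sym_C = count (last_symbols M) Sym_A"
  proof (induction M)
    case empty
    then show ?case by (simp add: R_def last_symbols_def)
  next
    case (add t M)
    then show ?case
      unfolding R_add_mset last_symbols_replace_term
      by (cases "last (snd t)") (simp_all add: last_symbols_def)
  qed
  then show "count (R M) Sym_A = count (last_symbols M) Sym_fA + count (last_symbols M) Sym_C"
    and "count (R M) Sym_fA = count (last_symbols M) Sym_C"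
    and "count (R M) Sym_C = count (last_symbols M) Sym_A"
    by simp_all
qed

lemma expansion_4: "expansion 4 = {# (Ini_f3, [Sym_A]), (Ini_f2, [Sym_fA]) #}"
  by (simp add: expansion.simps)

lemma expansion_Suc:
  assumes "b \<ge> 4"
  shows "expansion (Suc b) = \<Sum>\<^sub># (image_mset replace_term (expansion b))"
  using assms by (subst expansion.simps) simp

lemma padovan_add_3: "padovan (n + 3) = padovan (n + 1) + padovan n"
  by (simp add: numeral_3_eq_3)

lemma count_last_symbols_expansion:
  assumes "b \<ge> 4"
  shows "count (last_symbols (expansion b)) Sym_A = padovan (b + 1)"
    and "count (last_symbols (expansion b)) Sym_fA = padovan (b - 1)"
    and "count (last_symbols (expansion b)) Sym_C = padovan b"
proof -
  from assms
  have "count (last_symbols (expansion b)) Sym_A = padovan (b + 1)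
      \<and> count (last_symbols (expansion b)) Sym_fA = padovan (b - 1)
      \<and> count (last_symbols (expansion b)) Sym_C = padovan b"
  proof (induction b rule: dec_induct)
    case base
    show ?case unfolding expansion_4 by (simp add: last_symbols_def numeral_eq_Suc)
  next
    case (step b)
    have "padovan (Suc b + 1) = padovan b + padovan (b - 1)"
      using padovan_add_3[of "b - 1"] \<open>4 \<le> b\<close> by (simp add: numeral_3_eq_3)
    then show ?case
      using step by (simp add: expansion_Suc count_last_symbols_replace)
  qed
  then show "count (last_symbols (expansion b)) Sym_A = padovan (b + 1)"
    and "count (last_symbols (expansion b)) Sym_fA = padovan (b - 1)"
    and "count (last_symbols (expansion b)) Sym_C = padovan b"
    by simp_all
qed

theorem proposition3p8:
  fixes b :: nat
  assumes "b \<ge> 4"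
  shows "number_of_terms b = padovan (b + 4)"
proof -
  have "number_of_terms b = padovan (b + 1) + (padovan b + padovan (b - 1))"
    using assms by (simp add: number_of_terms_def size_eq_sum_of_last_symbol_counts
        count_last_symbols_expansion)
  also have "padovan b + padovan (b - 1) = padovan (b + 2)"
    using padovan_add_3[of "b - 1"] assms by (simp add: numeral_eq_Suc)
  also have "padovan (b + 1) + padovan (b + 2) = padovan (b + 4)"
    using padovan_add_3[of "b + 1"] by (simp add: numeral_eq_Suc)
  finally show ?thesis .
qed

end
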